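(* Let $S(X)$ be the free Steiner loop with free generators $X=\{x_1,x_2,x_3\}$. Then the group $\mathrm{Aut}(S(X))$ is generated by the symmetric group $\mathcal{S}_3$ (the automorphisms permuting $x_1,x_2,x_3$) and the elementary automorphism $\varphi=e_1(x_2)$, i.e. the automorphism with $\varphi(x_1)=x_1\cdot x_2$, $\varphi(x_2)=x_2$, $\varphi(x_3)=x_3$.
   Context: A Steiner loop is a commutative loop with identity $e$ satisfying $x\cdot x=e$ and $x\cdot(x\cdot y)=y$ for all $x,y$ (equivalently, a diassociative loop of exponent $2$). Steiner loops form a variety, and free objects are taken in this variety. *)

theory Defs
  imports "HOL-Algebra.Bij" "HOL-Algebra.Generated_Groups" "HOL-Combinatorics.Permutations"
begin

locale loop =
  fixes G (structure)
  assumes m_closed [intro, simp]: "\<lbrakk>x \<in> carrier G; y \<in> carrier G\<rbrakk> \<Longrightarrow> x \<otimes> y \<in> carrier G"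
    and one_closed [intro, simp]: "\<one> \<in> carrier G"
    and l_one [simp]: "x \<in> carrier G \<Longrightarrow> \<one> \<otimes> x = x"
    and r_one [simp]: "x \<in> carrier G \<Longrightarrow> x \<otimes> \<one> = x"
    and l_div: "\<lbrakk>x \<in> carrier G; y \<in> carrier G\<rbrakk> \<Longrightarrow> \<exists>!z. z \<in> carrier G \<and> x \<otimes> z = y"
    and r_div: "\<lbrakk>x \<in> carrier G; y \<in> carrier G\<rbrakk> \<Longrightarrow> \<exists>!z. z \<in> carrier G \<and> z \<otimes> x = y"

locale steiner_loop = loop +
  assumes m_comm: "\<lbrakk>x \<in> carrier G; y \<in> carrier G\<rbrakk> \<Longrightarrow> x \<otimes> y = y \<otimes> x"
    and m_self: "x \<in> carrier G \<Longrightarrow> x \<otimes> x = \<one>"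
    and m_cancel: "\<lbrakk>x \<in> carrier G; y \<in> carrier G\<rbrakk> \<Longrightarrow> x \<otimes> (x \<otimes> y) = y"

text \<open>
  The free Steiner loop on a set \<open>V\<close> is the algebra of terms over \<open>V\<close> modulo the least congruence
  containing all instances of the defining identities. The divisions need no
  operation symbols: in a Steiner loop both quotients of \<open>y\<close> by \<open>x\<close> equal \<open>x \<otimes> y\<close>.
\<close>

datatype 'a sterm = Unit | Var 'a | Mult "'a sterm" "'a sterm"

definition sterms :: "'a set \<Rightarrow> 'a sterm set" where
  "sterms V = {t. set_sterm t \<subseteq> V}"

inductive_set steiner_cong :: "'a set \<Rightarrow> ('a sterm \<times> 'a sterm) set" for V where
  refl: "t \<in> sterms V \<Longrightarrow> (t, t) \<in> steiner_cong V"
| sym: "(s, t) \<in> steiner_cong V \<Longrightarrow> (t, s) \<in> steiner_cong V"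
| trans: "(s, t) \<in> steiner_cong V \<Longrightarrow> (t, u) \<in> steiner_cong V \<Longrightarrow> (s, u) \<in> steiner_cong V"
| mult: "(s, s') \<in> steiner_cong V \<Longrightarrow> (t, t') \<in> steiner_cong V
    \<Longrightarrow> (Mult s t, Mult s' t') \<in> steiner_cong V"
| unit: "t \<in> sterms V \<Longrightarrow> (Mult Unit t, t) \<in> steiner_cong V"
| comm: "s \<in> sterms V \<Longrightarrow> t \<in> sterms V \<Longrightarrow> (Mult s t, Mult t s) \<in> steiner_cong V"
| self: "t \<in> sterms V \<Longrightarrow> (Mult t t, Unit) \<in> steiner_cong V"
| cancel: "s \<in> sterms V \<Longrightarrow> t \<in> sterms V \<Longrightarrow> (Mult s (Mult s t), t) \<in> steiner_cong V"

definition free_steiner_loop :: "'a set \<Rightarrow> 'a sterm set monoid" where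
  "free_steiner_loop V =
    \<lparr>carrier = sterms V // steiner_cong V,
     monoid.mult = (\<lambda>A B. \<Union>s\<in>A. \<Union>t\<in>B. steiner_cong V `` {Mult s t}),
     one = steiner_cong V `` {Unit}\<rparr>"

definition free_gen :: "'a set \<Rightarrow> 'a \<Rightarrow> 'a sterm set" where
  "free_gen V x = steiner_cong V `` {Var x}"

primrec sterm_eval :: "('b, 'c) monoid_scheme \<Rightarrow> ('a \<Rightarrow> 'b) \<Rightarrow> 'a sterm \<Rightarrow> 'b" where
  "sterm_eval K f Unit = \<one>\<^bsub>K\<^esub>"
| "sterm_eval K f (Var x) = f x"
| "sterm_eval K f (Mult s t) = sterm_eval K f s \<otimes>\<^bsub>K\<^esub> sterm_eval K f t"

text \<open>The homomorphism from the free Steiner loop to \<open>K\<close> that sends each free generator \<open>x\<close> to \<open>f x\<close>;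
  \<open>free_ext_hom\<close>, \<open>free_ext_gen\<close> and \<open>free_hom_eq\<close> below.\<close>

definition free_ext :: "'a set \<Rightarrow> ('b, 'c) monoid_scheme \<Rightarrow> ('a \<Rightarrow> 'b) \<Rightarrow> 'a sterm set \<Rightarrow> 'b" where
  "free_ext V K f = (\<lambda>A\<in>carrier (free_steiner_loop V). the_elem (sterm_eval K f ` A))"

definition perm_autos :: "'a set \<Rightarrow> ('a sterm set \<Rightarrow> 'a sterm set) set" where
  "perm_autos V =
    {free_ext V (free_steiner_loop V) (\<lambda>x. free_gen V (p x)) | p. p permutes V}"

text \<open>An automorphism if \<open>v\<close> lies in the subloop generated by \<open>V - {x}\<close>; a mere
  endomorphism in general.\<close>

definition elementary_auto :: "'a set \<Rightarrow> 'a \<Rightarrow> 'a sterm set \<Rightarrow> 'a sterm set \<Rightarrow> 'a sterm set" where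
  "elementary_auto V x v = free_ext V (free_steiner_loop V)
    (\<lambda>y. if y = x then free_gen V x \<otimes>\<^bsub>free_steiner_loop V\<^esub> v else free_gen V y)"

lemma Unit_sterms [simp]: "Unit \<in> sterms V"
  and Var_sterms [simp]: "Var x \<in> sterms V \<longleftrightarrow> x \<in> V"
  and Mult_sterms [simp]: "Mult s t \<in> sterms V \<longleftrightarrow> s \<in> sterms V \<and> t \<in> sterms V"
  by (auto simp: sterms_def)

lemma steiner_cong_sterms:
  assumes "(s, t) \<in> steiner_cong V"
  shows "s \<in> sterms V \<and> t \<in> sterms V"
  using assms by induction auto

lemma equiv_steiner_cong: "equiv (sterms V) (steiner_cong V)"
proof (rule equivI)
  show "steiner_cong V \<subseteq> sterms V \<times> sterms V" using steiner_cong_sterms by fastforce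
  show "refl_on (sterms V) (steiner_cong V)"
    by (auto simp: refl_on_def intro: steiner_cong.refl)
  show "sym (steiner_cong V)" by (rule symI) (rule steiner_cong.sym)
  show "trans (steiner_cong V)" by (rule transI) (rule steiner_cong.trans)
qed

lemma class_eq_iff:
  assumes "s \<in> sterms V" "t \<in> sterms V"
  shows "steiner_cong V `` {s} = steiner_cong V `` {t} \<longleftrightarrow> (s, t) \<in> steiner_cong V"
  using assms eq_equiv_class_iff[OF equiv_steiner_cong] by fast

lemma free_carrier_cases:
  assumes "A \<in> carrier (free_steiner_loop V)"
  obtains t where "t \<in> sterms V" "A = steiner_cong V `` {t}"
  using assms by (auto simp: free_steiner_loop_def elim: quotientE)

lemma class_carrier [simp]:
  "t \<in> sterms V \<Longrightarrow> steiner_cong V `` {t} \<in> carrier (free_steiner_loop V)"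
  by (auto simp: free_steiner_loop_def intro: quotientI)

lemma free_one: "\<one>\<^bsub>free_steiner_loop V\<^esub> = steiner_cong V `` {Unit}"
  by (simp add: free_steiner_loop_def)

lemma free_mult:
  assumes "s \<in> sterms V" "t \<in> sterms V"
  shows "steiner_cong V `` {s} \<otimes>\<^bsub>free_steiner_loop V\<^esub> steiner_cong V `` {t}
    = steiner_cong V `` {Mult s t}"
proof -
  have eq: "steiner_cong V `` {Mult s' t'} = steiner_cong V `` {Mult s t}"
    if "(s, s') \<in> steiner_cong V" "(t, t') \<in> steiner_cong V" for s' t'
    using equiv_class_eq[OF equiv_steiner_cong steiner_cong.mult[OF that]] by simp
  have "(s, s) \<in> steiner_cong V" "(t, t) \<in> steiner_cong V"
    using assms by (auto intro: steiner_cong.refl)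
  then have "(\<Union>s'\<in>steiner_cong V `` {s}. \<Union>t'\<in>steiner_cong V `` {t}. steiner_cong V `` {Mult s' t'})
      = steiner_cong V `` {Mult s t}"
    using eq by blast
  then show ?thesis by (simp add: free_steiner_loop_def)
qed

lemma steiner_loopI:
  fixes G (structure)
  assumes cl: "\<And>x y. \<lbrakk>x \<in> carrier G; y \<in> carrier G\<rbrakk> \<Longrightarrow> x \<otimes> y \<in> carrier G"
    and one: "\<one> \<in> carrier G" "\<And>x. x \<in> carrier G \<Longrightarrow> \<one> \<otimes> x = x"
    and comm: "\<And>x y. \<lbrakk>x \<in> carrier G; y \<in> carrier G\<rbrakk> \<Longrightarrow> x \<otimes> y = y \<otimes> x"
    and self: "\<And>x. x \<in> carrier G \<Longrightarrow> x \<otimes> x = \<one>"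
    and canc: "\<And>x y. \<lbrakk>x \<in> carrier G; y \<in> carrier G\<rbrakk> \<Longrightarrow> x \<otimes> (x \<otimes> y) = y"
  shows "steiner_loop G"
proof
  fix x y assume xy: "x \<in> carrier G" "y \<in> carrier G"
  show *: "\<exists>!z. z \<in> carrier G \<and> x \<otimes> z = y"
  proof (intro ex1I conjI)
    show "x \<otimes> y \<in> carrier G" "x \<otimes> (x \<otimes> y) = y" using xy by (simp_all add: cl canc)
    show "z = x \<otimes> y" if "z \<in> carrier G \<and> x \<otimes> z = y" for z using canc[of x z] xy that by auto
  qed
  have "z \<in> carrier G \<and> z \<otimes> x = y \<longleftrightarrow> z \<in> carrier G \<and> x \<otimes> z = y" for z
    using comm[OF _ xy(1)] by metis
  then show "\<exists>!z. z \<in> carrier G \<and> z \<otimes> x = y" using * by simp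
next
  show "x \<otimes> \<one> = x" if "x \<in> carrier G" for x
    using one(2)[OF that] comm[OF that one(1)] by simp
qed (fact cl one comm self canc)+

theorem steiner_loop_free: "steiner_loop (free_steiner_loop V)"
proof (rule steiner_loopI)
  fix x y assume "x \<in> carrier (free_steiner_loop V)" "y \<in> carrier (free_steiner_loop V)"
  then obtain s t where st: "s \<in> sterms V" "t \<in> sterms V"
    and xy: "x = steiner_cong V `` {s}" "y = steiner_cong V `` {t}"
    by (elim free_carrier_cases)
  show "x \<otimes>\<^bsub>free_steiner_loop V\<^esub> y \<in> carrier (free_steiner_loop V)"
    using st by (simp add: xy free_mult)
  show "x \<otimes>\<^bsub>free_steiner_loop V\<^esub> y = y \<otimes>\<^bsub>free_steiner_loop V\<^esub> x"
    using st by (simp add: xy free_mult class_eq_iff steiner_cong.comm)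
  show "x \<otimes>\<^bsub>free_steiner_loop V\<^esub> (x \<otimes>\<^bsub>free_steiner_loop V\<^esub> y) = y"
    using st by (simp add: xy free_mult class_eq_iff steiner_cong.cancel)
next
  fix x assume "x \<in> carrier (free_steiner_loop V)"
  then obtain t where t: "t \<in> sterms V" and x: "x = steiner_cong V `` {t}"
    by (elim free_carrier_cases)
  show "\<one>\<^bsub>free_steiner_loop V\<^esub> \<otimes>\<^bsub>free_steiner_loop V\<^esub> x = x"
    using t by (simp add: x free_mult free_one class_eq_iff steiner_cong.unit)
  show "x \<otimes>\<^bsub>free_steiner_loop V\<^esub> x = \<one>\<^bsub>free_steiner_loop V\<^esub>"
    using t by (simp add: x free_mult free_one class_eq_iff steiner_cong.self)
qed (simp add: free_one)

lemma free_gen_carrier [simp]: "x \<in> V \<Longrightarrow> free_gen V x \<in> carrier (free_steiner_loop V)"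
  by (simp add: free_gen_def)

lemma sterm_eval_carrier:
  assumes "steiner_loop K" "f \<in> V \<rightarrow> carrier K" "t \<in> sterms V"
  shows "sterm_eval K f t \<in> carrier K"
proof -
  interpret K: steiner_loop K by fact
  show ?thesis using assms(2,3) by (induction t) auto
qed

lemma sterm_eval_cong:
  assumes "steiner_loop K" "f \<in> V \<rightarrow> carrier K" "(s, t) \<in> steiner_cong V"
  shows "sterm_eval K f s = sterm_eval K f t"
proof -
  interpret K: steiner_loop K by fact
  show ?thesis using assms(3)
    by induction
      (simp_all add: sterm_eval_carrier[OF assms(1,2)] K.m_self K.m_cancel K.m_comm)
qed

lemma free_ext_class:
  assumes "steiner_loop K" "f \<in> V \<rightarrow> carrier K" "t \<in> sterms V"
  shows "free_ext V K f (steiner_cong V `` {t}) = sterm_eval K f t"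
proof -
  have "sterm_eval K f ` (steiner_cong V `` {t}) = {sterm_eval K f t}"
  proof (intro equalityI subsetI)
    fix a assume "a \<in> sterm_eval K f ` (steiner_cong V `` {t})"
    then obtain s where "(t, s) \<in> steiner_cong V" "a = sterm_eval K f s" by blast
    then show "a \<in> {sterm_eval K f t}" using sterm_eval_cong[OF assms(1,2)] by simp
  qed (use steiner_cong.refl[OF assms(3)] in blast)
  then show ?thesis using assms(3) by (simp add: free_ext_def)
qed

lemma free_ext_hom:
  assumes "steiner_loop K" "f \<in> V \<rightarrow> carrier K"
  shows "free_ext V K f \<in> hom (free_steiner_loop V) K"
proof (rule homI)
  fix x y assume "x \<in> carrier (free_steiner_loop V)" "y \<in> carrier (free_steiner_loop V)"
  then obtain s t where st: "s \<in> sterms V" "t \<in> sterms V"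
    and xy: "x = steiner_cong V `` {s}" "y = steiner_cong V `` {t}"
    by (elim free_carrier_cases)
  show "free_ext V K f x \<in> carrier K"
    using st by (simp add: xy free_ext_class[OF assms] sterm_eval_carrier[OF assms])
  show "free_ext V K f (x \<otimes>\<^bsub>free_steiner_loop V\<^esub> y) = free_ext V K f x \<otimes>\<^bsub>K\<^esub> free_ext V K f y"
    using st by (simp add: xy free_mult free_ext_class[OF assms])
qed

lemma free_ext_gen:
  assumes "steiner_loop K" "f \<in> V \<rightarrow> carrier K" "x \<in> V"
  shows "free_ext V K f (free_gen V x) = f x"
  using assms by (simp add: free_gen_def free_ext_class)

lemma free_hom_eq:
  assumes K: "steiner_loop K"
    and g: "g \<in> hom (free_steiner_loop V) K" and h: "h \<in> hom (free_steiner_loop V) K"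
    and eq: "\<And>x. x \<in> V \<Longrightarrow> g (free_gen V x) = h (free_gen V x)"
    and A: "A \<in> carrier (free_steiner_loop V)"
  shows "g A = h A"
proof -
  interpret K: steiner_loop K by fact
  interpret F: steiner_loop "free_steiner_loop V" by (rule steiner_loop_free)
  have one: "k \<one>\<^bsub>free_steiner_loop V\<^esub> = \<one>\<^bsub>K\<^esub>" if "k \<in> hom (free_steiner_loop V) K" for k
    using hom_mult[OF that F.one_closed F.one_closed] hom_in_carrier[OF that F.one_closed]
    by (simp add: K.m_self)
  have "g (steiner_cong V `` {t}) = h (steiner_cong V `` {t})" if "t \<in> sterms V" for t
    using that
  proof (induction t)
    case Unit
    then show ?case using one[OF g] one[OF h] by (simp add: free_one)
  next
    case (Var x)
    then show ?case using eq by (simp add: free_gen_def)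
  next
    case (Mult s t)
    then show ?case
      using hom_mult[OF g, of "steiner_cong V `` {s}" "steiner_cong V `` {t}"]
        hom_mult[OF h, of "steiner_cong V `` {s}" "steiner_cong V `` {t}"]
      by (simp add: free_mult)
  qed
  moreover obtain t where "t \<in> sterms V" "A = steiner_cong V `` {t}"
    using A by (rule free_carrier_cases)
  ultimately show ?thesis by simp
qed

theorem free_steiner_loop_universal:
  assumes "steiner_loop K" "f \<in> V \<rightarrow> carrier K"
  shows "\<exists>!h. h \<in> hom (free_steiner_loop V) K \<and> h \<in> extensional (carrier (free_steiner_loop V))
    \<and> (\<forall>x\<in>V. h (free_gen V x) = f x)"
proof (intro ex1I conjI)
  show "free_ext V K f \<in> hom (free_steiner_loop V) K" by (rule free_ext_hom[OF assms])
  show "free_ext V K f \<in> extensional (carrier (free_steiner_loop V))"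
    by (simp add: free_ext_def)
  show "\<forall>x\<in>V. free_ext V K f (free_gen V x) = f x" using free_ext_gen[OF assms] by blast
next
  fix h
  assume h: "h \<in> hom (free_steiner_loop V) K \<and> h \<in> extensional (carrier (free_steiner_loop V))
    \<and> (\<forall>x\<in>V. h (free_gen V x) = f x)"
  have "h A = free_ext V K f A" if "A \<in> carrier (free_steiner_loop V)" for A
  proof (rule free_hom_eq[OF assms(1) _ free_ext_hom[OF assms] _ that])
    show "h \<in> hom (free_steiner_loop V) K" using h by blast
    show "h (free_gen V x) = free_ext V K f (free_gen V x)" if "x \<in> V" for x
      using h that free_ext_gen[OF assms that] by simp
  qed
  then show "h = free_ext V K f"
    using h by (intro extensionalityI[where A = "carrier (free_steiner_loop V)"])
      (simp_all add: free_ext_def)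
qed

text \<open>The library proves this only for groups.\<close>

lemma (in loop) group_AutoGroup: "group (AutoGroup G)"
proof -
  interpret B: group "BijGroup (carrier G)" by (rule group_BijGroup)
  have "subgroup (auto G) (BijGroup (carrier G))"
  proof (rule subgroup.intro)
    show "auto G \<subseteq> carrier (BijGroup (carrier G))"
      by (simp add: auto_def BijGroup_def)
    have "(\<lambda>x\<in>carrier G. x) \<in> hom G G" by (rule homI) simp_all
    then show "\<one>\<^bsub>BijGroup (carrier G)\<^esub> \<in> auto G"
      by (simp add: auto_def BijGroup_def id_Bij)
  next
    fix h assume h: "h \<in> auto G"
    then have hB: "h \<in> Bij (carrier G)" and hh: "h \<in> hom G G" by (simp_all add: auto_def)
    have G: "(\<otimes>) \<in> carrier G \<rightarrow> carrier G \<rightarrow> carrier G" by simp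
    have "(\<lambda>x\<in>carrier G. inv_into (carrier G) h x) \<in> hom G G"
      using Bij_inv_into_lemma[OF hom_mult[OF hh] hB G]
      by (intro homI) (simp_all add: Bij_inv_into_mem[OF hB])
    then show "inv\<^bsub>BijGroup (carrier G)\<^esub> h \<in> auto G"
      by (simp add: auto_def inv_BijGroup[OF hB] restrict_inv_into_Bij[OF hB])
  next
    fix h k assume "h \<in> auto G" "k \<in> auto G"
    then have B: "h \<in> Bij (carrier G)" "k \<in> Bij (carrier G)"
      and h: "h \<in> hom G G" and k: "k \<in> hom G G" by (simp_all add: auto_def)
    have "compose (carrier G) h k \<in> hom G G"
      by (rule homI)
        (simp_all add: compose_def hom_in_carrier[OF h] hom_in_carrier[OF k] hom_mult[OF h] hom_mult[OF k])
    then show "h \<otimes>\<^bsub>BijGroup (carrier G)\<^esub> k \<in> auto G"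
      using B by (simp add: auto_def BijGroup_def compose_Bij)
  qed
  then show ?thesis
    using subgroup.subgroup_is_group group_BijGroup by (auto simp: AutoGroup_def)
qed

lemma elementary_auto_gen:
  assumes "x \<in> V" "v \<in> carrier (free_steiner_loop V)" "y \<in> V"
  shows "elementary_auto V x v (free_gen V y) =
    (if y = x then free_gen V x \<otimes>\<^bsub>free_steiner_loop V\<^esub> v else free_gen V y)"
proof -
  interpret F: steiner_loop "free_steiner_loop V" by (rule steiner_loop_free)
  show ?thesis
    unfolding elementary_auto_def using assms
    by (subst free_ext_gen[OF steiner_loop_free]) simp_all
qed

end

theory Submission imports Defs
begin

text \<open>
  Nielsen reduction. In normal form, a product \<open>c = a \<otimes> b\<close> of distinct nonunit elements is either
  reduced, with the length of \<open>c\<close> the sum of the lengths of \<open>a\<close> and \<open>b\<close>, or cancels because one factor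
  is the reduced product of the other one with \<open>c\<close>. Let \<open>\<phi>\<close> be an automorphism for which no
  replacement of \<open>\<phi> x\<close> by \<open>\<phi> x \<otimes> \<phi> v\<close>, with \<open>v\<close> a word in the other generators, reduces the length.
  Then \<open>\<phi>\<close> maps reduced products to reduced products: if \<open>\<phi> s = \<phi> t \<otimes> z\<close> were reduced, then \<open>s\<close> would
  be a reduced product with factor \<open>t\<close> by uniqueness of reduced factors and injectivity, or a
  generator admitting a replacement. So only generators can be mapped to generators,
  and \<open>\<phi>\<close> permutes them by surjectivity. For three generators, \<open>v\<close> lies in a loop
  with four elements, and each of the corresponding replacements is composed of permutations and
  \<open>a \<mapsto> a \<otimes> b\<close>.
\<close>

section \<open>Normal forms of Steiner terms\<close>

text \<open>Choosing an order of the factors once and for all makes \<open>npair\<close> an unordered product.\<close>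

definition npair :: "'a sterm \<Rightarrow> 'a sterm \<Rightarrow> 'a sterm" where
  "npair s t = (let p = (SOME p. {fst p, snd p} = {s, t}) in Mult (fst p) (snd p))"

lemma npair_cases: "npair s t = Mult s t \<or> npair s t = Mult t s"
proof -
  define p where "p = (SOME p. {fst p, snd p} = {s, t})"
  have "{fst p, snd p} = {s, t}" unfolding p_def by (rule someI[of _ "(s, t)"]) simp
  moreover have "npair s t = Mult (fst p) (snd p)" by (simp add: npair_def p_def Let_def)
  ultimately show ?thesis by (auto simp: doubleton_eq_iff)
qed

lemma npair_comm: "npair s t = npair t s"
  by (simp add: npair_def insert_commute)

lemma npair_eq_iff: "npair s t = npair s' t' \<longleftrightarrow> s = s' \<and> t = t' \<or> s = t' \<and> t = s'"
  using npair_cases[of s t] npair_cases[of s' t'] npair_comm by (metis sterm.inject(2))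

lemma npair_simps [simp]:
  "npair s t \<noteq> Unit" "npair s t \<noteq> Var x" "Unit \<noteq> npair s t" "Var x \<noteq> npair s t"
  "npair s t \<in> sterms V \<longleftrightarrow> s \<in> sterms V \<and> t \<in> sterms V"
  using npair_cases[of s t] by auto

text \<open>With weights \<open>len (h (Var x))\<close> for a homomorphism \<open>h\<close>, this is
  the length that \<open>h t\<close> has if nothing cancels.\<close>

primrec wlen :: "('a \<Rightarrow> nat) \<Rightarrow> 'a sterm \<Rightarrow> nat" where
  "wlen w Unit = 0"
| "wlen w (Var x) = w x"
| "wlen w (Mult s t) = wlen w s + wlen w t"

lemma wlen_npair [simp]: "wlen w (npair s t) = wlen w s + wlen w t"
  using npair_cases[of s t] by auto

lemma wlen_ge_weight: "x \<in> set_sterm t \<Longrightarrow> w x \<le> wlen w t"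
  by (induction t) auto

lemma wlen_mono: "(\<And>x. x \<in> set_sterm t \<Longrightarrow> w x \<le> w' x) \<Longrightarrow> wlen w t \<le> wlen w' t"
  by (induction t) (auto intro: add_mono)

abbreviation len :: "'a sterm \<Rightarrow> nat" where
  "len \<equiv> wlen (\<lambda>_. 1)"

text \<open>The side conditions exclude the products that reduce at the root by
  \<open>x * x = 1\<close> or \<open>x * (x * y) = y\<close>. Leaving out \<open>Unit\<close> takes
  care of the unit law, \<open>npair\<close> of commutativity.\<close>

inductive_set nform :: "'a set \<Rightarrow> 'a sterm set" for V where
  Var: "x \<in> V \<Longrightarrow> Var x \<in> nform V"
| Pair: "\<lbrakk>s \<in> nform V; t \<in> nform V; s \<noteq> t; \<nexists>z. s = npair t z; \<nexists>z. t = npair s z\<rbrakk>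
    \<Longrightarrow> npair s t \<in> nform V"

lemma Unit_nform [simp]: "Unit \<notin> nform V"
proof
  assume "Unit \<in> nform V"
  then show False by cases simp_all
qed

lemma Var_nform [simp]: "Var x \<in> nform V \<longleftrightarrow> x \<in> V"
proof
  assume "Var x \<in> nform V"
  then show "x \<in> V" by cases simp_all
qed (rule nform.Var)

lemma nform_npairD:
  assumes "npair s t \<in> nform V"
  shows "s \<in> nform V" "t \<in> nform V" "s \<noteq> t" "\<And>z. s \<noteq> npair t z" "\<And>z. t \<noteq> npair s z"
proof -
  obtain a b where "npair s t = npair a b" and ab: "a \<in> nform V" "b \<in> nform V" "a \<noteq> b"
      "\<nexists>z. a = npair b z" "\<nexists>z. b = npair a z"
    using assms by cases auto
  then have "s = a \<and> t = b \<or> s = b \<and> t = a" by (simp add: npair_eq_iff)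
  then show "s \<in> nform V" "t \<in> nform V" "s \<noteq> t" "\<And>z. s \<noteq> npair t z" "\<And>z. t \<noteq> npair s z"
    using ab by blast+
qed

lemma nform_sterms: "t \<in> nform V \<Longrightarrow> t \<in> sterms V"
  by (induction rule: nform.induct) auto

text \<open>The variable set enters only at the leaves. This moves a normal form in which
  \<open>x\<close> does not occur into \<open>nform (V - {x})\<close>, where irreducibility
  applies.\<close>

lemma nform_mono:
  assumes "t \<in> nform V" "t \<in> sterms W"
  shows "t \<in> nform W"
  using assms by (induction rule: nform.induct) (auto intro: nform.Pair)

lemma nform_len_pos: "t \<in> nform V \<Longrightarrow> 0 < len t"
  by (induction rule: nform.induct) auto

lemma nform_len_1:
  assumes "t \<in> nform V" "len t \<le> 1"
  obtains x where "x \<in> V" "t = Var x"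
  using assms(1)
proof cases
  case (Pair s u)
  then show ?thesis using assms(2) nform_len_pos[of s V] nform_len_pos[of u V] by simp
qed (use that in blast)

text \<open>A proper subterm is smaller. So of two terms at most one has the other as a factor, and
  the two absorption tests in \<open>nmult\<close> exclude each other.\<close>

lemma npair_neq [simp]: "npair (npair s t) z \<noteq> s" "npair (npair t s) z \<noteq> s"
    "npair z (npair s t) \<noteq> s" "npair z (npair t s) \<noteq> s" "npair s z \<noteq> s" "npair z s \<noteq> s"
proof -
  have size: "size (npair a b) = size a + size b + 1" for a b :: "'a sterm"
    using npair_cases[of a b] by auto
  show "npair (npair s t) z \<noteq> s" "npair (npair t s) z \<noteq> s"
    "npair z (npair s t) \<noteq> s" "npair z (npair t s) \<noteq> s" "npair s z \<noteq> s" "npair z s \<noteq> s"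
    by (rule notI, drule arg_cong[where f = size], simp add: size)+
qed

section \<open>The Steiner loop of normal forms\<close>

text \<open>For normal factors a single reduction at the root is enough. Each \<open>THE\<close> is
  well defined because \<open>npair t\<close> is injective.\<close>

definition nmult :: "'a sterm \<Rightarrow> 'a sterm \<Rightarrow> 'a sterm" where
  "nmult s t =
    (if s = Unit then t else if t = Unit then s else if s = t then Unit
     else if \<exists>z. s = npair t z then THE z. s = npair t z
     else if \<exists>z. t = npair s z then THE z. t = npair s z
     else npair s t)"

lemma nmult_Unit [simp]: "nmult Unit t = t" "nmult t Unit = t" "nmult t t = Unit"
  by (simp_all add: nmult_def)

lemma nmult_npair:
  assumes "t \<noteq> Unit"
  shows "nmult (npair t s) t = s" "nmult t (npair t s) = s"
    "nmult (npair s t) t = s" "nmult t (npair s t) = s"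
proof -
  have *: "npair t s = npair t z \<longleftrightarrow> z = s" for z
    by (auto simp: npair_eq_iff)
  have "\<nexists>z. t = npair (npair t s) z" by (metis npair_neq)
  then show **: "nmult (npair t s) t = s" "nmult t (npair t s) = s"
    using assms by (simp_all only: nmult_def * npair_simps npair_neq npair_neq[symmetric]
        if_False if_True simp_thms the_eq_trivial)
  show "nmult (npair s t) t = s" "nmult t (npair s t) = s"
    using ** by (simp_all only: npair_comm[of s t])
qed

lemma nmult_cases:
  assumes "s \<in> nform V" "t \<in> nform V" "s \<noteq> t"
  obtains (left) z where "s = npair t z" "nmult s t = z" "z \<in> nform V"
    | (right) z where "t = npair s z" "nmult s t = z" "z \<in> nform V"
    | (pair) "nmult s t = npair s t" "npair s t \<in> nform V"
proof -
  have nU: "s \<noteq> Unit" "t \<noteq> Unit" using assms by auto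
  consider z where "s = npair t z" | z where "t = npair s z"
    | "\<nexists>z. s = npair t z" "\<nexists>z. t = npair s z" by blast
  then show ?thesis
  proof cases
    case 1
    then show ?thesis using left[OF 1] assms(1) nmult_npair(1)[OF nU(2)] nform_npairD(2)[of t z V] by simp
  next
    case 2
    then show ?thesis using right[OF 2] assms(2) nmult_npair(2)[OF nU(1)] nform_npairD(2)[of s z V] by simp
  next
    case 3
    then have "nmult s t = npair s t" using nU assms(3) by (simp add: nmult_def)
    then show ?thesis using 3 pair assms nform.Pair by blast
  qed
qed

lemma nmult_eq_npair:
  assumes "npair s t \<in> nform V"
  shows "nmult s t = npair s t"
proof -
  have "s \<noteq> Unit" "t \<noteq> Unit" using nform_npairD(1,2)[OF assms] by auto
  then show ?thesis using nform_npairD(3-5)[OF assms] by (simp add: nmult_def)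
qed

definition norm_loop :: "'a set \<Rightarrow> 'a sterm monoid" where
  "norm_loop V = \<lparr>carrier = insert Unit (nform V), monoid.mult = nmult, one = Unit\<rparr>"

lemma norm_loop_simps [simp]:
  "carrier (norm_loop V) = insert Unit (nform V)"
  "s \<otimes>\<^bsub>norm_loop V\<^esub> t = nmult s t" "\<one>\<^bsub>norm_loop V\<^esub> = Unit"
  by (simp_all add: norm_loop_def)

lemma nmult_comm:
  assumes "s \<in> insert Unit (nform V)" "t \<in> insert Unit (nform V)"
  shows "nmult s t = nmult t s"
proof (cases "s = Unit \<or> t = Unit \<or> s = t")
  case False
  then have st: "s \<in> nform V" "t \<in> nform V" "s \<noteq> t" "s \<noteq> Unit" "t \<noteq> Unit" using assms by auto
  from st(1-3) show ?thesis
  proof (cases rule: nmult_cases)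
    case (left z)
    then show ?thesis using nmult_npair[OF st(5)] by simp
  next
    case (right z)
    then show ?thesis using nmult_npair[OF st(4)] by simp
  next
    case pair
    then show ?thesis using nmult_eq_npair npair_comm by metis
  qed
qed auto

lemma steiner_loop_norm: "steiner_loop (norm_loop V)"
proof (rule steiner_loopI, unfold norm_loop_simps)
  fix s t assume st: "s \<in> insert Unit (nform V)" "t \<in> insert Unit (nform V)"
  show "nmult s t \<in> insert Unit (nform V)"
  proof (cases "s = Unit \<or> t = Unit \<or> s = t")
    case False
    then have "s \<in> nform V" "t \<in> nform V" "s \<noteq> t" using st by auto
    then show ?thesis by (cases rule: nmult_cases) auto
  qed (use st in auto)
  show "nmult s t = nmult t s" using st by (rule nmult_comm)
  \<comment> \<open>If \<open>s\<close> has the factor \<open>t\<close>, the product is the other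
    factor \<open>z\<close>, and \<open>s\<close> times \<open>z\<close> uncovers \<open>t\<close>.
    If \<open>t\<close> has the factor \<open>s\<close>, then \<open>s\<close> and the product
    \<open>z\<close> rejoin to the reduced \<open>t\<close>. If the product is reduced,
    \<open>s\<close> is stripped off again.\<close>
  show "nmult s (nmult s t) = t"
  proof (cases "s = Unit \<or> t = Unit \<or> s = t")
    case False
    then have st': "s \<in> nform V" "t \<in> nform V" "s \<noteq> t" "s \<noteq> Unit" "t \<noteq> Unit" using st by auto
    from st'(1-3) show ?thesis
    proof (cases rule: nmult_cases)
      case (left z)
      then have "z \<noteq> Unit" by auto
      then show ?thesis using left nmult_npair(3)[of z t] by simp
    next
      case (right z)
      then show ?thesis using st'(2) nmult_eq_npair[of s z V] by simp
    next
      case pair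
      then show ?thesis using nmult_npair(2)[OF st'(4)] by simp
    qed
  qed auto
qed simp_all

section \<open>Isomorphism between the free Steiner loop and the normal forms\<close>

definition nf :: "'a set \<Rightarrow> 'a sterm set \<Rightarrow> 'a sterm" where
  "nf V = free_ext V (norm_loop V) Var"

lemma nf_hom: "nf V \<in> hom (free_steiner_loop V) (norm_loop V)"
  unfolding nf_def by (rule free_ext_hom[OF steiner_loop_norm]) simp

lemma nf_gen [simp]: "x \<in> V \<Longrightarrow> nf V (free_gen V x) = Var x"
  unfolding nf_def by (rule free_ext_gen[OF steiner_loop_norm]) simp_all

lemma nf_one [simp]: "nf V \<one>\<^bsub>free_steiner_loop V\<^esub> = Unit"
  by (simp add: nf_def free_one free_ext_class[OF steiner_loop_norm])

text \<open>Evaluating a normal term in \<open>norm_loop V\<close> meets only reduced products and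
  so returns the term itself. Hence distinct normal terms represent distinct elements of the free
  loop.\<close>

lemma nf_class:
  assumes "t \<in> insert Unit (nform V)"
  shows "nf V (steiner_cong V `` {t}) = t"
proof -
  have "nf V (steiner_cong V `` {t}) = t" if "t \<in> nform V" for t
    using that
  proof induction
    case (Var x)
    then show ?case using nf_gen by (simp add: free_gen_def)
  next
    case (Pair s t)
    then have "npair s t \<in> nform V" by (blast intro: nform.Pair)
    then have e: "nmult s t = npair s t" "nmult t s = npair s t"
      by (metis nmult_eq_npair npair_comm)+
    have st: "s \<in> sterms V" "t \<in> sterms V" using Pair nform_sterms by auto
    \<comment> \<open>Both orders are computed, since it is unknown which one the choice in
      \<open>npair\<close> has fixed.\<close>
    have "nf V (steiner_cong V `` {Mult s t}) = npair s t"
      "nf V (steiner_cong V `` {Mult t s}) = npair s t"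
      using hom_mult[OF nf_hom, of "steiner_cong V `` {s}" V "steiner_cong V `` {t}"]
        hom_mult[OF nf_hom, of "steiner_cong V `` {t}" V "steiner_cong V `` {s}"] st
      by (simp_all add: free_mult Pair.IH e)
    then show ?case using npair_cases[of s t] by auto
  qed
  then show ?thesis using assms nf_one[of V] by (auto simp: free_one)
qed

lemma class_npair:
  assumes "s \<in> sterms V" "t \<in> sterms V"
  shows "steiner_cong V `` {npair s t} = steiner_cong V `` {s} \<otimes>\<^bsub>free_steiner_loop V\<^esub> steiner_cong V `` {t}"
proof -
  interpret F: steiner_loop "free_steiner_loop V" by (rule steiner_loop_free)
  show ?thesis
    using npair_cases[of s t] F.m_comm free_mult[OF assms] free_mult[OF assms(2,1)] class_carrier assms
    by metis
qed

text \<open>Each case of \<open>nmult\<close> is an instance of a law that holds in every Steiner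
  loop.\<close>

lemma class_hom: "(\<lambda>t. steiner_cong V `` {t}) \<in> hom (norm_loop V) (free_steiner_loop V)"
proof (rule homI)
  interpret F: steiner_loop "free_steiner_loop V" by (rule steiner_loop_free)
  have cl: "steiner_cong V `` {t} \<in> carrier (free_steiner_loop V)" if "t \<in> nform V" for t
    using that by (simp add: nform_sterms)
  show "steiner_cong V `` {t} \<in> carrier (free_steiner_loop V)" if "t \<in> carrier (norm_loop V)" for t
    using that cl by auto
  fix s t assume st: "s \<in> carrier (norm_loop V)" "t \<in> carrier (norm_loop V)"
  show "steiner_cong V `` {s \<otimes>\<^bsub>norm_loop V\<^esub> t}
    = steiner_cong V `` {s} \<otimes>\<^bsub>free_steiner_loop V\<^esub> steiner_cong V `` {t}"
  proof (cases "s = Unit \<or> t = Unit \<or> s = t")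
    case True
    moreover have "steiner_cong V `` {Unit} = \<one>\<^bsub>free_steiner_loop V\<^esub>" by (rule free_one[symmetric])
    moreover have "steiner_cong V `` {u} \<in> carrier (free_steiner_loop V)" if "u \<in> {s, t}" for u
      using that st cl by auto
    ultimately show ?thesis using F.m_self by (elim disjE) simp_all
  next
    case False
    then have st': "s \<in> nform V" "t \<in> nform V" "s \<noteq> t" using st by auto
    note c = class_npair[OF nform_sterms nform_sterms]
    from st' show ?thesis
    proof (cases rule: nmult_cases)
      case (left z)
      then have "steiner_cong V `` {s} = steiner_cong V `` {t} \<otimes>\<^bsub>free_steiner_loop V\<^esub> steiner_cong V `` {z}"
        using c[OF st'(2) left(3)] left(1) by simp
      then show ?thesis using left(2,3) st'(2) cl F.m_cancel F.m_comm by simp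
    next
      case (right z)
      then have "steiner_cong V `` {t} = steiner_cong V `` {s} \<otimes>\<^bsub>free_steiner_loop V\<^esub> steiner_cong V `` {z}"
        using c[OF st'(1) right(3)] right(1) by simp
      then show ?thesis using right(2,3) st'(1) cl F.m_cancel by simp
    next
      case pair
      then show ?thesis using c st' by simp
    qed
  qed
qed

text \<open>Taking the class of the normal form is an endomorphism that fixes the generators, hence
  the identity. Together with \<open>nf_class\<close> this makes \<open>nf V\<close> an
  isomorphism.\<close>

lemma class_nf:
  assumes "A \<in> carrier (free_steiner_loop V)"
  shows "steiner_cong V `` {nf V A} = A"
proof -
  have "((\<lambda>t. steiner_cong V `` {t}) \<circ> nf V) A = id A"
  proof (rule free_hom_eq[OF steiner_loop_free _ _ _ assms])
    show "(\<lambda>t. steiner_cong V `` {t}) \<circ> nf V \<in> hom (free_steiner_loop V) (free_steiner_loop V)"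
      by (rule hom_compose[OF nf_hom class_hom])
    show "id \<in> hom (free_steiner_loop V) (free_steiner_loop V)"
      by (auto simp: hom_def)
    show "((\<lambda>t. steiner_cong V `` {t}) \<circ> nf V) (free_gen V x) = id (free_gen V x)" if "x \<in> V" for x
      using nf_gen[OF that] by (simp add: free_gen_def)
  qed
  then show ?thesis by simp
qed

section \<open>Lengths under injective homomorphisms\<close>

text \<open>\<open>h Unit\<close> equals its own square, and every square is
  \<open>Unit\<close>.\<close>

lemma hom_norm_loop_one:
  assumes "h \<in> hom (norm_loop V) (norm_loop W)"
  shows "h Unit = Unit"
  using hom_mult[OF assms, of Unit Unit] by simp

text \<open>Cancellation in the image of a product is traced down to a generator, where
  \<open>irr\<close> forbids it, or to a factor shared with a composite term, where normality does.
  The induction runs on length because its hypothesis is also applied to factors of a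
  factor.\<close>

lemma len_hom_irreducible:
  assumes h: "h \<in> hom (norm_loop V) (norm_loop W)"
    and inj: "inj_on h (carrier (norm_loop V))"
    and irr: "\<And>x t. \<lbrakk>x \<in> V; t \<in> nform (V - {x})\<rbrakk> \<Longrightarrow> len (h (Var x)) \<le> len (nmult (h (Var x)) (h t))"
    and t: "t \<in> nform V"
  shows "len (h t) = wlen (\<lambda>x. len (h (Var x))) t"
  using t
proof (induction "len t" arbitrary: t rule: less_induct)
  case less
  let ?w = "wlen (\<lambda>x. len (h (Var x)))"
  have hN: "h s \<in> nform W" if "s \<in> nform V" for s
  proof -
    have "h s \<noteq> Unit"
      using that inj_onD[OF inj, of s Unit] hom_norm_loop_one[OF h] by auto
    then show ?thesis using hom_in_carrier[OF h, of s] that by auto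
  qed
  have hinj: "h s = h u \<longleftrightarrow> s = u" if "s \<in> nform V" "u \<in> nform V" for s u
    using inj_on_eq_iff[OF inj] that by simp
  \<comment> \<open>By the trichotomy \<open>nmult_cases\<close>, excluding absorption in both
    directions leaves only a reduced product of the images.\<close>
  have no_absorb: "h a \<noteq> npair (h b) z" if ab: "npair a b \<in> nform V" and t: "t = npair a b" for a b z
  proof
    assume eq: "h a = npair (h b) z"
    note N = nform_npairD[OF ab]
    have la: "len a < len t" "len b < len t"
      using nform_len_pos[OF N(1)] nform_len_pos[OF N(2)] t by simp_all
    have zN: "z \<in> nform W" using hN[OF N(1)] nform_npairD(2) eq by metis
    from N(1) show False
    proof cases
      case (Var x)
      \<comment> \<open>By the induction hypothesis \<open>?w b\<close> is the length of
        \<open>h b\<close>. A generator occurring in \<open>b\<close> contributes its full weight to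
        \<open>?w b\<close>, so \<open>x\<close> is too heavy to occur there.\<close>
      have "?w b < len (h (Var x))"
        using eq Var nform_len_pos[OF zN] less(1)[OF la(2) N(2)] by simp
      then have "x \<notin> set_sterm b" using wlen_ge_weight[of x b "\<lambda>x. len (h (Var x))"] by auto
      then have "b \<in> nform (V - {x})"
        using nform_sterms[OF N(2)] by (intro nform_mono[OF N(2)]) (auto simp: sterms_def)
      moreover have "h b \<noteq> Unit" using hN[OF N(2)] by auto
      \<comment> \<open>Multiplying \<open>h (Var x)\<close> by \<open>h b\<close> leaves
        \<open>z\<close>, which is strictly shorter, against \<open>irr\<close>.\<close>
      ultimately show False
        using irr[OF Var(2)] Var eq nform_len_pos[OF hN[OF N(2)]] nmult_npair(1)[of "h b" z] by fastforce
    next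
      case (Pair p q)
      have pq: "len p < len t" "len q < len t" using la Pair(1) by simp_all
      have ne: "h p \<noteq> h q" using Pair hinj by simp
      have "nmult p q = npair p q"
        using N(1) Pair(1) nmult_eq_npair by metis
      then have "h a = nmult (h p) (h q)"
        using hom_mult[OF h, of p q] Pair by simp
      \<comment> \<open>The induction hypothesis at \<open>a\<close>, \<open>p\<close> and
        \<open>q\<close> makes the lengths add up. Absorption would leave something shorter than one
        of the factors, so the product of \<open>h p\<close> and \<open>h q\<close> is
        reduced.\<close>
      moreover have "len (h a) = len (h p) + len (h q)"
        using less(1)[OF la(1) N(1)] less(1)[OF pq(1)] less(1)[OF pq(2)] Pair by simp
      ultimately have len: "len (nmult (h p) (h q)) = len (h p) + len (h q)" by simp
      from hN[OF Pair(2)] hN[OF Pair(3)] ne have "nmult (h p) (h q) = npair (h p) (h q)"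
      proof (cases rule: nmult_cases)
        case (left z)
        then show ?thesis using len nform_len_pos[OF hN[OF Pair(3)]]
            arg_cong[OF left(1), of len] by simp
      next
        case (right z)
        then show ?thesis using len nform_len_pos[OF hN[OF Pair(2)]]
            arg_cong[OF right(1), of len] by simp
      qed
      \<comment> \<open>A reduced product determines its factors, so injectivity makes
        \<open>b\<close> a factor of \<open>a\<close>; then \<open>npair a b\<close> would not be
        normal.\<close>
      then have "npair (h p) (h q) = npair (h b) z"
        using eq \<open>h a = nmult (h p) (h q)\<close> by simp
      then have "h b = h p \<or> h b = h q" by (auto simp: npair_eq_iff)
      then have "b = p \<or> b = q" using hinj N(2) Pair by simp
      then show False using N(4) Pair(1) npair_comm by metis
    qed
  qed
  from less(2) show ?case
  proof cases
    case (Pair a b)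
    have ab: "npair a b \<in> nform V" using less(2) Pair(1) by simp
    have lens: "len a < len t" "len b < len t"
      using nform_len_pos[OF Pair(2)] nform_len_pos[OF Pair(3)] Pair(1) by simp_all
    have ne: "h a \<noteq> h b" using Pair hinj by simp
    have "h t = nmult (h a) (h b)"
      using hom_mult[OF h, of a b] Pair nmult_eq_npair[OF ab] by simp
    also have "\<dots> = npair (h a) (h b)"
      using hN[OF Pair(2)] hN[OF Pair(3)] ne
    proof (cases rule: nmult_cases)
      case (left z)
      then show ?thesis using no_absorb[OF ab Pair(1)] by blast
    next
      case (right z)
      then show ?thesis using no_absorb[of b a z] ab Pair(1) npair_comm by metis
    qed
    finally show ?thesis
      using less(1)[OF lens(1) Pair(2)] less(1)[OF lens(2) Pair(3)] Pair(1) by simp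
  qed simp
qed

section \<open>Automorphisms given by their values on generators\<close>

lemma auto_carrier: "\<phi> \<in> auto G \<Longrightarrow> A \<in> carrier G \<Longrightarrow> \<phi> A \<in> carrier G"
  unfolding auto_def by (blast dest: hom_in_carrier)

lemma auto_mult:
  "\<lbrakk>\<phi> \<in> auto G; A \<in> carrier G; B \<in> carrier G\<rbrakk> \<Longrightarrow> \<phi> (A \<otimes>\<^bsub>G\<^esub> B) = \<phi> A \<otimes>\<^bsub>G\<^esub> \<phi> B"
  unfolding auto_def by (blast dest: hom_mult)

lemma AutoGroup_mult_apply:
  "\<lbrakk>\<phi> \<in> auto G; \<psi> \<in> auto G; A \<in> carrier G\<rbrakk> \<Longrightarrow> (\<phi> \<otimes>\<^bsub>AutoGroup G\<^esub> \<psi>) A = \<phi> (\<psi> A)"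
  by (simp add: AutoGroup_def BijGroup_def auto_def compose_def)

lemma carrier_AutoGroup [simp]: "carrier (AutoGroup G) = auto G"
  by (simp add: AutoGroup_def)

lemma auto_eq_free_ext:
  assumes "\<phi> \<in> auto (free_steiner_loop V)" "f \<in> V \<rightarrow> carrier (free_steiner_loop V)"
    and "\<And>x. x \<in> V \<Longrightarrow> \<phi> (free_gen V x) = f x"
  shows "\<phi> = free_ext V (free_steiner_loop V) f"
proof (rule extensionalityI[where A = "carrier (free_steiner_loop V)"])
  show "\<phi> \<in> extensional (carrier (free_steiner_loop V))"
    using assms(1) by (auto simp: auto_def Bij_def)
  show "free_ext V (free_steiner_loop V) f \<in> extensional (carrier (free_steiner_loop V))"
    by (simp add: free_ext_def)
  fix A assume A: "A \<in> carrier (free_steiner_loop V)"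
  have "\<phi> \<in> hom (free_steiner_loop V) (free_steiner_loop V)"
    using assms(1) by (simp add: auto_def)
  then show "\<phi> A = free_ext V (free_steiner_loop V) f A"
    using free_ext_hom[OF steiner_loop_free assms(2)] _ A
  proof (rule free_hom_eq[OF steiner_loop_free])
    show "\<phi> (free_gen V x) = free_ext V (free_steiner_loop V) f (free_gen V x)" if "x \<in> V" for x
      using assms(3) free_ext_gen[OF steiner_loop_free assms(2)] that by simp
  qed
qed

text \<open>Homomorphisms out of a free loop are determined on generators, so two endomorphisms that
  undo each other there are mutually inverse everywhere.\<close>

lemma free_ext_auto:
  fixes V :: "'a set" and f g :: "'a \<Rightarrow> 'a sterm set"
  defines "F \<equiv> free_steiner_loop V"
  assumes fg: "f \<in> V \<rightarrow> carrier F" "g \<in> V \<rightarrow> carrier F"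
    and inv: "\<And>x. x \<in> V \<Longrightarrow> free_ext V F f (g x) = free_gen V x"
      "\<And>x. x \<in> V \<Longrightarrow> free_ext V F g (f x) = free_gen V x"
  shows "free_ext V F f \<in> auto F"
proof -
  have S: "steiner_loop F" unfolding F_def by (rule steiner_loop_free)
  have hom: "free_ext V F f \<in> hom F F" "free_ext V F g \<in> hom F F"
    using free_ext_hom[OF S] fg unfolding F_def by blast+
  have comp: "free_ext V F k (free_ext V F l A) = A"
    if kl: "k \<in> V \<rightarrow> carrier F" "l \<in> V \<rightarrow> carrier F" and A: "A \<in> carrier F"
      and eq: "\<And>x. x \<in> V \<Longrightarrow> free_ext V F k (l x) = free_gen V x" for k l A
  proof -
    have "(free_ext V F k \<circ> free_ext V F l) A = id A"
    proof (rule free_hom_eq[OF S _ _ _ A[unfolded F_def]])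
      show "free_ext V F k \<circ> free_ext V F l \<in> hom (free_steiner_loop V) F"
        using hom_compose free_ext_hom[OF S] kl unfolding F_def by blast
      show "id \<in> hom (free_steiner_loop V) F" by (auto simp: hom_def F_def)
      show "(free_ext V F k \<circ> free_ext V F l) (free_gen V x) = id (free_gen V x)" if "x \<in> V" for x
        using eq[OF that] free_ext_gen[OF S kl(2) that] by simp
    qed
    then show ?thesis by simp
  qed
  have "bij_betw (free_ext V F f) (carrier F) (carrier F)"
  proof (rule bij_betw_byWitness[where f' = "free_ext V F g"])
    show "\<forall>A\<in>carrier F. free_ext V F g (free_ext V F f A) = A"
      using comp fg inv by blast
    show "\<forall>A\<in>carrier F. free_ext V F f (free_ext V F g A) = A"
      using comp fg inv by blast
  qed (use hom[THEN hom_in_carrier] in blast)+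
  moreover have "free_ext V F f \<in> extensional (carrier F)"
    by (simp add: free_ext_def F_def)
  ultimately show ?thesis using hom(1) by (simp add: auto_def Bij_def)
qed

lemma perm_autos_auto: "perm_autos V \<subseteq> auto (free_steiner_loop V)"
proof
  fix \<phi> assume "\<phi> \<in> perm_autos V"
  then obtain p where p: "p permutes V"
    and \<phi>: "\<phi> = free_ext V (free_steiner_loop V) (\<lambda>x. free_gen V (p x))"
    by (auto simp: perm_autos_def)
  have ip: "inv_into UNIV p permutes V" using p by (rule permutes_inv)
  have c: "(\<lambda>x. free_gen V (q x)) \<in> V \<rightarrow> carrier (free_steiner_loop V)" if "q permutes V" for q
    using that permutes_in_image by fastforce
  note e = free_ext_gen[OF steiner_loop_free c]
  show "\<phi> \<in> auto (free_steiner_loop V)"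
    unfolding \<phi>
  proof (rule free_ext_auto[OF c[OF p] c[OF ip]])
    fix x assume "x \<in> V"
    then have "inv_into UNIV p x \<in> V" "p x \<in> V" using p ip permutes_in_image by metis+
    then show "free_ext V (free_steiner_loop V) (\<lambda>x. free_gen V (p x)) (free_gen V (inv_into UNIV p x)) = free_gen V x"
      "free_ext V (free_steiner_loop V) (\<lambda>x. free_gen V (inv_into UNIV p x)) (free_gen V (p x)) = free_gen V x"
      using e[OF p] e[OF ip] permutes_inverses[OF p] by simp_all
  qed
qed

text \<open>The map is its own inverse, since \<open>(x * y) * y = x\<close>.\<close>

lemma elementary_auto_gen_auto:
  assumes "x \<in> V" "y \<in> V" "x \<noteq> y"
  shows "elementary_auto V x (free_gen V y) \<in> auto (free_steiner_loop V)"
proof -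
  interpret F: steiner_loop "free_steiner_loop V" by (rule steiner_loop_free)
  let ?f = "\<lambda>z. if z = x then free_gen V x \<otimes>\<^bsub>free_steiner_loop V\<^esub> free_gen V y else free_gen V z"
  have f: "?f \<in> V \<rightarrow> carrier (free_steiner_loop V)" using assms by auto
  have "free_ext V (free_steiner_loop V) ?f (?f z) = free_gen V z" if z: "z \<in> V" for z
  proof (cases "z = x")
    case True
    have "free_gen V x \<otimes>\<^bsub>free_steiner_loop V\<^esub> free_gen V y \<otimes>\<^bsub>free_steiner_loop V\<^esub> free_gen V y = free_gen V x"
      using assms F.m_cancel[of "free_gen V y" "free_gen V x"]
        F.m_comm[of "free_gen V y" "free_gen V x"]
        F.m_comm[of "free_gen V y" "free_gen V x \<otimes>\<^bsub>free_steiner_loop V\<^esub> free_gen V y"] by simp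
    then show ?thesis
      using True assms hom_mult[OF free_ext_hom[OF steiner_loop_free f], of "free_gen V x" "free_gen V y"]
        free_ext_gen[OF steiner_loop_free f] by simp
  qed (use free_ext_gen[OF steiner_loop_free f z] in simp)
  then show ?thesis
    unfolding elementary_auto_def by (intro free_ext_auto[OF f f])
qed

section \<open>Irreducible automorphisms permute the generators\<close>

definition deg :: "'a set \<Rightarrow> 'a sterm set \<Rightarrow> nat" where
  "deg V A = len (nf V A)"

lemma irreducible_auto_perm:
  assumes \<phi>: "\<phi> \<in> auto (free_steiner_loop V)" and fin: "finite V"
    and irr: "\<And>x t. \<lbrakk>x \<in> V; t \<in> sterms (V - {x})\<rbrakk> \<Longrightarrow> deg V (\<phi> (free_gen V x))
      \<le> deg V (\<phi> (free_gen V x) \<otimes>\<^bsub>free_steiner_loop V\<^esub> \<phi> (steiner_cong V `` {t}))"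
  shows "\<phi> \<in> perm_autos V"
proof -
  let ?F = "free_steiner_loop V"
  have \<phi>h: "\<phi> \<in> hom ?F ?F" and \<phi>b: "bij_betw \<phi> (carrier ?F) (carrier ?F)"
    using \<phi> by (auto simp: auto_def Bij_def)
  \<comment> \<open>This is \<open>\<phi>\<close> transported to normal forms.\<close>
  define h where "h = nf V \<circ> (\<phi> \<circ> (\<lambda>t. steiner_cong V `` {t}))"
  have h: "h \<in> hom (norm_loop V) (norm_loop V)"
    unfolding h_def by (intro hom_compose[OF _ nf_hom] hom_compose[OF class_hom \<phi>h])
  have nf_inj: "A = B" if "nf V A = nf V B" "A \<in> carrier ?F" "B \<in> carrier ?F" for A B
    using that class_nf by metis
  have inj: "inj_on h (carrier (norm_loop V))"
  proof (rule inj_onI)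
    fix s t assume st: "s \<in> carrier (norm_loop V)" "t \<in> carrier (norm_loop V)" and eq: "h s = h t"
    have c: "steiner_cong V `` {s} \<in> carrier ?F" "steiner_cong V `` {t} \<in> carrier ?F"
      using st hom_in_carrier[OF class_hom] by blast+
    then have "\<phi> (steiner_cong V `` {s}) = \<phi> (steiner_cong V `` {t})"
      using eq nf_inj hom_in_carrier[OF \<phi>h] by (simp add: h_def)
    then have "steiner_cong V `` {s} = steiner_cong V `` {t}"
      using c \<phi>b by (metis bij_betw_def inj_onD)
    then show "s = t" using nf_class st by (metis norm_loop_simps(1))
  qed
  have h_Var: "h (Var x) = nf V (\<phi> (free_gen V x))" for x
    by (simp add: h_def free_gen_def)
  have len_h: "len (h t) = wlen (\<lambda>x. len (h (Var x))) t" if "t \<in> nform V" for t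
  proof (rule len_hom_irreducible[OF h inj _ that])
    fix x t assume x: "x \<in> V" and t: "t \<in> nform (V - {x})"
    have ts: "t \<in> sterms (V - {x})" "t \<in> sterms V"
      using nform_sterms[OF t] by (auto simp: sterms_def)
    have c: "\<phi> (steiner_cong V `` {t}) \<in> carrier ?F" "\<phi> (free_gen V x) \<in> carrier ?F"
      using hom_in_carrier[OF \<phi>h] x ts by simp_all
    have "nmult (h (Var x)) (h t) = nf V (\<phi> (free_gen V x) \<otimes>\<^bsub>?F\<^esub> \<phi> (steiner_cong V `` {t}))"
      using hom_mult[OF nf_hom c(2,1)] h_Var by (simp add: h_def)
    then show "len (h (Var x)) \<le> len (nmult (h (Var x)) (h t))"
      using irr[OF x ts(1)] h_Var by (simp add: deg_def)
  qed
  have h_pos: "1 \<le> len (h (Var x))" if "x \<in> V" for x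
  proof -
    have "h (Var x) \<noteq> Unit"
      using that inj_onD[OF inj, of "Var x" Unit] hom_norm_loop_one[OF h] by auto
    then have "h (Var x) \<in> nform V" using hom_in_carrier[OF h, of "Var x"] that by simp
    then show ?thesis using nform_len_pos by fastforce
  qed
  have "\<exists>x\<in>V. \<phi> (free_gen V x) = free_gen V y" if y: "y \<in> V" for y
  proof -
    obtain A where A: "A \<in> carrier ?F" "\<phi> A = free_gen V y"
      using \<phi>b free_gen_carrier[OF y] by (metis bij_betw_def imageE)
    define t where "t = nf V A"
    have At: "A = steiner_cong V `` {t}" using class_nf[OF A(1)] by (simp add: t_def)
    have ht: "h t = Var y" using A(2) nf_gen[OF y] by (simp add: h_def flip: At)
    then have "t \<noteq> Unit" using hom_norm_loop_one[OF h] by auto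
    then have t: "t \<in> nform V" using hom_in_carrier[OF nf_hom A(1)] by (simp add: t_def)
    \<comment> \<open>All weights are at least 1, so \<open>t\<close> is no longer than
      \<open>h t = Var y\<close>. Hence the preimage of a generator is a generator.\<close>
    have "len t \<le> wlen (\<lambda>x. len (h (Var x))) t"
      using nform_sterms[OF t] h_pos by (intro wlen_mono) (auto simp: sterms_def)
    then have "len t \<le> 1" using len_h[OF t] ht by simp
    then obtain x where "x \<in> V" "t = Var x" using nform_len_1[OF t] by blast
    then show ?thesis using A(2) At by (auto simp: free_gen_def)
  qed
  then obtain g where g: "\<And>y. y \<in> V \<Longrightarrow> g y \<in> V \<and> \<phi> (free_gen V (g y)) = free_gen V y"
    by metis
  have gen_inj: "x = y" if "free_gen V x = free_gen V y" "x \<in> V" "y \<in> V" for x y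
    using that nf_gen by (metis sterm.inject(1))
  \<comment> \<open>\<open>\<phi>\<close> recovers \<open>y\<close> from \<open>g y\<close>, so
    \<open>g\<close> is injective, and by finiteness onto. Thus every generator is mapped to a
    generator.\<close>
  have "inj_on g V" by (rule inj_onI) (metis g gen_inj)
  moreover from this have "g ` V = V" using g fin by (intro endo_inj_surj) auto
  ultimately have gb: "bij_betw g V V" by (simp add: bij_betw_def)
  \<comment> \<open>\<open>g\<close> leads from images back to preimages, so its inverse describes
    \<open>\<phi>\<close>. \<open>permutes\<close> demands fixed points outside
    \<open>V\<close>.\<close>
  define p where "p x = (if x \<in> V then inv_into V g x else x)" for x
  have "bij_betw p V V"
    using bij_betw_inv_into[OF gb] by (rule bij_betw_cong[THEN iffD1, rotated]) (simp add: p_def)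
  then have p: "p permutes V" by (rule bij_imp_permutes) (simp add: p_def)
  have "\<phi> (free_gen V x) = free_gen V (p x)" if "x \<in> V" for x
    using g[of "p x"] bij_betw_inv_into_right[OF gb that] bij_betwE[OF bij_betw_inv_into[OF gb]] that
    by (simp add: p_def)
  then have "\<phi> = free_ext V ?F (\<lambda>x. free_gen V (p x))"
    using p permutes_in_image by (intro auto_eq_free_ext[OF \<phi>]) fastforce+
  then show ?thesis using p by (auto simp: perm_autos_def)
qed

section \<open>Generation of the automorphism group for three generators\<close>

text \<open>The multiplication table is that of the Klein four-group, though some of the listed
  elements may coincide.\<close>

lemma (in steiner_loop) two_generated_closed:
  assumes ab: "a \<in> carrier G" "b \<in> carrier G"
    and "p \<in> {\<one>, a, b, a \<otimes> b}" "q \<in> {\<one>, a, b, a \<otimes> b}"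
  shows "p \<otimes> q \<in> {\<one>, a, b, a \<otimes> b}"
proof -
  have ba: "b \<otimes> a = a \<otimes> b" "(a \<otimes> b) \<otimes> a = b" "(a \<otimes> b) \<otimes> b = a" "b \<otimes> (a \<otimes> b) = a"
    using ab m_comm m_cancel m_closed by metis+
  show ?thesis
    using assms(3,4) by (elim insertE emptyE) (simp_all add: ab ba m_self m_cancel)
qed

text \<open>With three generators, the words in two of them thus take only four values, so only
  finitely many replacements remain to be treated.\<close>

lemma two_generated_class:
  assumes "x \<in> V" "y \<in> V" "t \<in> sterms {x, y}"
  shows "steiner_cong V `` {t} \<in> {\<one>\<^bsub>free_steiner_loop V\<^esub>, free_gen V x, free_gen V y,
    free_gen V x \<otimes>\<^bsub>free_steiner_loop V\<^esub> free_gen V y}"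
proof -
  interpret F: steiner_loop "free_steiner_loop V" by (rule steiner_loop_free)
  show ?thesis
    using assms(3)
  proof (induction t)
    case (Mult s t)
    then have "s \<in> sterms V" "t \<in> sterms V" using assms(1,2) by (auto simp: sterms_def)
    then show ?case
      using Mult F.two_generated_closed[OF free_gen_carrier[OF assms(1)] free_gen_carrier[OF assms(2)]]
      by (metis Mult_sterms free_mult)
  qed (auto simp: free_one free_gen_def)
qed

theorem theorem10:
  fixes x1 x2 x3 :: 'a and V :: "'a set"
  assumes "distinct [x1, x2, x3]" and "V = {x1, x2, x3}"
  shows "generate (AutoGroup (free_steiner_loop V))
      (perm_autos V \<union> {elementary_auto V x1 (free_gen V x2)})
    = carrier (AutoGroup (free_steiner_loop V))"
proof -
  let ?F = "free_steiner_loop V"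
  let ?e = "elementary_auto V x1 (free_gen V x2)"
  let ?M = "perm_autos V \<union> {?e}"
  let ?H = "generate (AutoGroup ?F) ?M"
  interpret F: steiner_loop ?F by (rule steiner_loop_free)
  interpret A: group "AutoGroup ?F" by (rule F.group_AutoGroup)
  have d: "x1 \<noteq> x2" "x1 \<noteq> x3" "x2 \<noteq> x3" and V: "x1 \<in> V" "x2 \<in> V" "x3 \<in> V"
    using assms by auto
  have e: "?e \<in> auto ?F" by (rule elementary_auto_gen_auto[OF V(1,2) d(1)])
  have M: "?M \<subseteq> carrier (AutoGroup ?F)" using e perm_autos_auto by auto
  interpret H: subgroup ?H "AutoGroup ?F" by (rule A.generate_is_subgroup[OF M])
  have step: "\<phi> \<in> ?H" if "\<phi> \<in> auto ?F" "m \<in> ?M" "\<phi> \<otimes>\<^bsub>AutoGroup ?F\<^esub> m \<in> ?H" for \<phi> m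
  proof -
    have "m \<in> ?H" using that(2) by (rule generate.incl)
    then have "\<phi> \<otimes>\<^bsub>AutoGroup ?F\<^esub> m \<otimes>\<^bsub>AutoGroup ?F\<^esub> inv\<^bsub>AutoGroup ?F\<^esub> m \<in> ?H"
      using that(3) by blast
    moreover have "m \<in> carrier (AutoGroup ?F)" "\<phi> \<in> carrier (AutoGroup ?F)"
      using that(1,2) M by auto
    ultimately show ?thesis by (simp add: A.m_assoc del: carrier_AutoGroup)
  qed
  \<comment> \<open>Membership in \<open>?H\<close> is stated through the triple of images. It holds
    vacuously for triples that come from no automorphism, so moves on triples can be chained without
    naming the automorphisms.\<close>
  define P where "P a b c \<longleftrightarrow> (\<forall>\<phi>\<in>auto ?F. \<phi> (free_gen V x1) = a \<longrightarrow> \<phi> (free_gen V x2) = b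
    \<longrightarrow> \<phi> (free_gen V x3) = c \<longrightarrow> \<phi> \<in> ?H)" for a b c
  \<comment> \<open>Composing with \<open>m\<close> on the right replaces the images
    \<open>a\<close>, \<open>b\<close>, \<open>c\<close> by words in them, and \<open>step\<close>
    cancels \<open>m\<close> again.\<close>
  have PI: "P a b c" if m: "m \<in> ?M" and P: "P a' b' c'"
    and img: "\<And>\<phi>. \<lbrakk>\<phi> \<in> auto ?F; \<phi> (free_gen V x1) = a; \<phi> (free_gen V x2) = b; \<phi> (free_gen V x3) = c\<rbrakk>
      \<Longrightarrow> \<phi> (m (free_gen V x1)) = a' \<and> \<phi> (m (free_gen V x2)) = b' \<and> \<phi> (m (free_gen V x3)) = c'"
    for a b c a' b' c' m
    unfolding P_def
  proof (intro ballI impI)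
    fix \<phi> assume \<phi>: "\<phi> \<in> auto ?F" "\<phi> (free_gen V x1) = a" "\<phi> (free_gen V x2) = b" "\<phi> (free_gen V x3) = c"
    have ma: "m \<in> auto ?F" using m M by auto
    have "\<phi> \<otimes>\<^bsub>AutoGroup ?F\<^esub> m \<in> auto ?F"
      using A.m_closed[of \<phi> m] \<phi>(1) ma by simp
    then have "\<phi> \<otimes>\<^bsub>AutoGroup ?F\<^esub> m \<in> ?H"
      using P img[OF \<phi>] V AutoGroup_mult_apply[OF \<phi>(1) ma] by (simp add: P_def)
    then show "\<phi> \<in> ?H" by (rule step[OF \<phi>(1) m])
  qed
  define \<pi> where "\<pi> x y = free_ext V ?F (\<lambda>z. free_gen V (transpose x y z))" for x y
  have \<pi>: "\<pi> x y \<in> ?M" if "x \<in> V" "y \<in> V" for x y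
    using permutes_swap_id[OF that] by (auto simp: \<pi>_def perm_autos_def)
  have \<pi>_gen: "\<pi> x y (free_gen V z) = free_gen V (transpose x y z)" if "x \<in> V" "y \<in> V" "z \<in> V" for x y z
    unfolding \<pi>_def using that permutes_in_image[OF permutes_swap_id[OF that(1,2)]]
    by (intro free_ext_gen[OF steiner_loop_free]) auto
  have swap12: "P a b c" if "P b a c" for a b c
    using d V \<pi>_gen by (intro PI[OF \<pi>[OF V(1,2)] that]) simp
  have swap23: "P a b c" if "P a c b" for a b c
    using d V \<pi>_gen by (intro PI[OF \<pi>[OF V(2,3)] that]) simp
  have mult12: "P a b c" if "P (a \<otimes>\<^bsub>?F\<^esub> b) b c" for a b c
    using d V elementary_auto_gen[OF V(1)]
    by (intro PI[OF _ that, of ?e]) (simp_all add: auto_mult)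
  \<comment> \<open>This is \<open>mult12\<close> conjugated by the exchange of the second and third
    entries.\<close>
  have mult13: "P a b c" if "P (a \<otimes>\<^bsub>?F\<^esub> c) b c" for a b c
    by (rule swap23, rule mult12, rule swap23) (rule that)
  \<comment> \<open>The second entry is turned into \<open>b * c\<close>, multiplied onto
    \<open>a\<close>, and then turned back into \<open>b\<close> by a second multiplication with
    \<open>c\<close>. The steps below run through these moves from the last to the first.\<close>
  have mult123: "P a b c" if P: "P (a \<otimes>\<^bsub>?F\<^esub> (b \<otimes>\<^bsub>?F\<^esub> c)) b c"
    and cl: "b \<in> carrier ?F" "c \<in> carrier ?F" for a b c
  proof -
    have *: "(b \<otimes>\<^bsub>?F\<^esub> c) \<otimes>\<^bsub>?F\<^esub> c = b"
      using F.m_cancel F.m_comm F.m_closed cl by metis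
    have "P b (a \<otimes>\<^bsub>?F\<^esub> (b \<otimes>\<^bsub>?F\<^esub> c)) c" using P by (rule swap12)
    then have "P ((b \<otimes>\<^bsub>?F\<^esub> c) \<otimes>\<^bsub>?F\<^esub> c) (a \<otimes>\<^bsub>?F\<^esub> (b \<otimes>\<^bsub>?F\<^esub> c)) c" by (simp only: *)
    then have "P (b \<otimes>\<^bsub>?F\<^esub> c) (a \<otimes>\<^bsub>?F\<^esub> (b \<otimes>\<^bsub>?F\<^esub> c)) c" by (rule mult13)
    then have "P a (b \<otimes>\<^bsub>?F\<^esub> c) c" by (rule mult12[OF swap12])
    then have "P b a c" by (rule mult13[OF swap12])
    then show ?thesis by (rule swap12)
  qed
  have mult: "P a b c" if "P (a \<otimes>\<^bsub>?F\<^esub> v) b c" "v \<in> {b, c, b \<otimes>\<^bsub>?F\<^esub> c}"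
    "b \<in> carrier ?F" "c \<in> carrier ?F" for a b c v
    using that mult12 mult13 mult123 by blast
  have P: "P a b c" if "a \<in> carrier ?F" "b \<in> carrier ?F" "c \<in> carrier ?F" for a b c
    using that
  proof (induction "deg V a + deg V b + deg V c" arbitrary: a b c rule: less_induct)
    case less
    \<comment> \<open>\<open>a'\<close>, \<open>b'\<close>, \<open>c'\<close> will be a
      rearrangement of \<open>a\<close>, \<open>b\<close>, \<open>c\<close>, which keeps the total
      degree. Multiplying by the unit reduces nothing, so \<open>v\<close> is one of the three
      factors covered by \<open>mult\<close>.\<close>
    have red: "P a' b' c'" if "a' \<in> carrier ?F" "b' \<in> carrier ?F" "c' \<in> carrier ?F"
      and "deg V a' + deg V b' + deg V c' = deg V a + deg V b + deg V c"
      and v: "v \<in> {\<one>\<^bsub>?F\<^esub>, b', c', b' \<otimes>\<^bsub>?F\<^esub> c'}" and lt: "deg V (a' \<otimes>\<^bsub>?F\<^esub> v) < deg V a'"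
      for a' b' c' v
    proof -
      have "v \<noteq> \<one>\<^bsub>?F\<^esub>" using lt that(1) by auto
      then have "v \<in> {b', c', b' \<otimes>\<^bsub>?F\<^esub> c'}" using v by blast
      moreover from v have "v \<in> carrier ?F" using that(2,3) by auto
      then have "P (a' \<otimes>\<^bsub>?F\<^esub> v) b' c'" using that(1-4) lt by (intro less.hyps) auto
      ultimately show ?thesis using mult that(2,3) by blast
    qed
    show ?case
      unfolding P_def
    proof (intro ballI impI)
      fix \<phi> assume \<phi>: "\<phi> \<in> auto ?F" and
        g: "\<phi> (free_gen V x1) = a" "\<phi> (free_gen V x2) = b" "\<phi> (free_gen V x3) = c"
      have \<phi>1: "\<phi> \<one>\<^bsub>?F\<^esub> = \<one>\<^bsub>?F\<^esub>"
        using auto_mult[OF \<phi> F.one_closed F.one_closed] auto_carrier[OF \<phi> F.one_closed] by (simp add: F.m_self)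
      have two: "\<phi> (steiner_cong V `` {t}) \<in> {\<one>\<^bsub>?F\<^esub>, \<phi> (free_gen V y), \<phi> (free_gen V z),
          \<phi> (free_gen V y) \<otimes>\<^bsub>?F\<^esub> \<phi> (free_gen V z)}"
        if "y \<in> V" "z \<in> V" "t \<in> sterms {y, z}" for y z t
        using two_generated_class[OF that] \<phi>1 auto_mult[OF \<phi>, of "free_gen V y" "free_gen V z"] that
        by (elim insertE emptyE) simp_all
      show "\<phi> \<in> ?H"
      \<comment> \<open>Either some replacement lowers the total degree and \<open>red\<close>
        applies after moving \<open>x\<close> to the front, or \<open>\<phi>\<close> is irreducible
        and therefore a permutation of the generators.\<close>
      proof (cases "\<exists>x\<in>V. \<exists>t\<in>sterms (V - {x}).
          deg V (\<phi> (free_gen V x) \<otimes>\<^bsub>?F\<^esub> \<phi> (steiner_cong V `` {t})) < deg V (\<phi> (free_gen V x))")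
        case True
        then obtain x t where xt: "x \<in> V" "t \<in> sterms (V - {x})"
          and lt: "deg V (\<phi> (free_gen V x) \<otimes>\<^bsub>?F\<^esub> \<phi> (steiner_cong V `` {t})) < deg V (\<phi> (free_gen V x))"
          by blast
        have "P a b c"
        proof -
          consider "x = x1" | "x = x2" | "x = x3" using xt assms(2) by auto
          then show ?thesis
          proof cases
            case 1
            then have "V - {x} = {x2, x3}" using d assms(2) by auto
            then show ?thesis
              using red[of a b c "\<phi> (steiner_cong V `` {t})"] two[OF V(2,3), of t] xt(2) lt less.prems 1 g by simp
          next
            case 2
            then have "V - {x} = {x1, x3}" using d assms(2) by auto
            then have "P b a c"
              using red[of b a c "\<phi> (steiner_cong V `` {t})"] two[OF V(1,3), of t] xt(2) lt less.prems 2 g by simp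
            then show ?thesis by (rule swap12)
          next
            case 3
            then have "V - {x} = {x1, x2}" using d assms(2) by auto
            then have "P c a b"
              using red[of c a b "\<phi> (steiner_cong V `` {t})"] two[OF V(1,2), of t] xt(2) lt less.prems 3 g by simp
            then show ?thesis by (rule swap23[OF swap12])
          qed
        qed
        then show ?thesis using \<phi> g by (simp add: P_def)
      next
        case False
        then have "\<phi> \<in> perm_autos V"
          using assms(2) by (intro irreducible_auto_perm[OF \<phi>]) (auto simp: not_less)
        then show ?thesis by (blast intro: generate.incl)
      qed
    qed
  qed
  have "auto ?F \<subseteq> ?H"
  proof
    fix \<phi> assume \<phi>: "\<phi> \<in> auto ?F"
    then show "\<phi> \<in> ?H"
      using P[of "\<phi> (free_gen V x1)" "\<phi> (free_gen V x2)" "\<phi> (free_gen V x3)"] V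
        auto_carrier[OF \<phi>] by (simp add: P_def)
  qed
  then show ?thesis using A.generate_incl[OF M] by auto
qed

end
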